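(* The domination polynomial of the Petersen graph $P$ is $$D(P,x)=x^{10}+\binom{10}{9}x^9+\binom{10}{8}x^8+\binom{10}{7}x^7+\left[\binom{10}{6}-10\right]x^6+\left[\binom{10}{5}-60\right]x^5+75x^4+10x^3.$$
   Context: For a vertex $v$ of a finite simple graph $G$, $N[v]$ denotes the closed neighborhood of $v$ ($v$ together with its neighbors). A set $S\subseteq V(G)$ is a dominating set of $G$ if $\bigcup_{v\in S}N[v]=V(G)$. Let $d(G,i)$ be the number of dominating sets of $G$ of cardinality $i$, and let $\gamma(G)$ be the minimum cardinality of a dominating set. The domination polynomial of $G$ is $D(G,x)=\sum_{i=\gamma(G)}^{|V(G)|} d(G,i)x^i$. The Petersen graph $P$ is the usual cubic graph on 10 vertices. *)

theory Defs
  imports "Graph_Theory.Digraph" "HOL-Computational_Algebra.Polynomial"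
begin

text \<open>
  A finite simple undirected graph is a symmetric digraph without loops and multiple arcs
  (locale \<^locale>\<open>graph\<close>); each edge \<open>{u, v}\<close> is represented by the two arcs \<open>(u, v)\<close>
  and \<open>(v, u)\<close>.
\<close>

definition closed_neighborhood :: "('a, 'b) pre_digraph \<Rightarrow> 'a \<Rightarrow> 'a set" where
  "closed_neighborhood G v = insert v {u. v \<rightarrow>\<^bsub>G\<^esub> u}"

definition dominating_set :: "('a, 'b) pre_digraph \<Rightarrow> 'a set \<Rightarrow> bool" where
  "dominating_set G S \<longleftrightarrow> S \<subseteq> verts G \<and> (\<Union>v\<in>S. closed_neighborhood G v) = verts G"

definition num_dominating_sets :: "('a, 'b) pre_digraph \<Rightarrow> nat \<Rightarrow> nat" where
  "num_dominating_sets G i = card {S. dominating_set G S \<and> card S = i}"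

definition domination_number :: "('a, 'b) pre_digraph \<Rightarrow> nat" where
  "domination_number G = Min (card ` {S. dominating_set G S})"

definition domination_poly :: "('a, 'b) pre_digraph \<Rightarrow> int poly" where
  "domination_poly G =
     (\<Sum>i = domination_number G..card (verts G). monom (int (num_dominating_sets G i)) i)"

text \<open>
  The usual drawing of the Petersen graph: the outer pentagon on \<open>0, \<dots>, 4\<close>, the spokes
  \<open>{i, i + 5}\<close>, and the inner pentagram on \<open>5, \<dots>, 9\<close>.
\<close>

definition petersen_edges :: "nat set set" where
  "petersen_edges =
     (\<Union>i\<in>{..<5}. {{i, (i + 1) mod 5}, {i, i + 5}, {i + 5, (i + 2) mod 5 + 5}})"

definition petersen :: "(nat, nat \<times> nat) pre_digraph" where
  "petersen = \<lparr>verts = {..<10}, arcs = {(u, v). {u, v} \<in> petersen_edges}, tail = fst, head = snd\<rparr>"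

text \<open>
  The next lemmas confirm that this is a cubic graph on 10 vertices, and that it is strongly
  regular with parameters \<open>(10, 3, 0, 1)\<close>, which determines the Petersen graph up to isomorphism.
\<close>

lemma petersen_edges_eq:
  "petersen_edges =
     {{0,1},{1,2},{2,3},{3,4},{4,0},{0,5},{1,6},{2,7},{3,8},{4,9},{5,7},{6,8},{7,9},{8,5},{9,6}}"
proof -
  have "{..<5} = {0, 1, 2, 3, 4 :: nat}" by auto
  then show ?thesis
    unfolding petersen_edges_def by (simp add: insert_commute numeral_2_eq_2)
qed

lemma petersen_adj_iff: "u \<rightarrow>\<^bsub>petersen\<^esub> v \<longleftrightarrow> {u, v} \<in> petersen_edges"
  by (auto simp: arcs_ends_conv petersen_def)

lemma petersen_edges_bound: "{u, v} \<in> petersen_edges \<Longrightarrow> u < 10"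
  unfolding petersen_edges_eq by (simp only: insert_iff empty_iff doubleton_eq_iff) (elim disjE; simp)

lemma petersen_neighbors:
  "{v. u \<rightarrow>\<^bsub>petersen\<^esub> v} =
     (if u < 10 then [{1,4,5},{0,2,6},{1,3,7},{2,4,8},{0,3,9},
                      {0,7,8},{1,8,9},{2,5,9},{3,5,6},{4,6,7}] ! u else {})"
proof (cases "u < 10")
  case True
  then have "u \<in> {0,1,2,3,4,5,6,7,8,9}" by auto
  then show ?thesis
    unfolding petersen_adj_iff petersen_edges_eq
    by (elim insertE emptyE; simp add: doubleton_eq_iff; auto)
next
  case False
  then show ?thesis
    unfolding petersen_adj_iff using petersen_edges_bound by auto
qed

lemma petersen_graph: "graph petersen"
proof -
  have bound: "v < 10" if "{u, v} \<in> petersen_edges" for u v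
    using petersen_edges_bound[of v u] that by (simp add: insert_commute)
  have noloop: "{u, u} \<notin> petersen_edges" for u
    unfolding petersen_edges_eq by (auto simp: doubleton_eq_iff)
  have sub: "arcs petersen \<subseteq> {..<10} \<times> {..<10}"
    by (auto simp: petersen_def dest: petersen_edges_bound bound)
  have "finite (arcs petersen)"
    by (rule finite_subset[OF sub]) simp
  then show ?thesis
    using noloop by unfold_locales
      (auto simp: petersen_def arc_to_ends_def symmetric_conv insert_commute
        dest: petersen_edges_bound bound)
qed

lemma petersen_verts: "verts petersen = {0,1,2,3,4,5,6,7,8,9}"
  by (auto simp: petersen_def)

lemma petersen_order: "card (verts petersen) = 10"
  by (simp add: petersen_def)

lemma petersen_cubic:
  assumes "u \<in> verts petersen"
  shows "card {v. u \<rightarrow>\<^bsub>petersen\<^esub> v} = 3"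
proof -
  from assms have "u \<in> {0,1,2,3,4,5,6,7,8,9}" unfolding petersen_verts .
  then show ?thesis unfolding petersen_neighbors by auto
qed

lemma petersen_common_neighbors:
  assumes "u \<in> verts petersen" "v \<in> verts petersen" "u \<noteq> v"
  shows "card ({w. u \<rightarrow>\<^bsub>petersen\<^esub> w} \<inter> {w. v \<rightarrow>\<^bsub>petersen\<^esub> w}) = (if u \<rightarrow>\<^bsub>petersen\<^esub> v then 0 else 1)"
proof -
  have adj: "u \<rightarrow>\<^bsub>petersen\<^esub> v \<longleftrightarrow> v \<in> {w. u \<rightarrow>\<^bsub>petersen\<^esub> w}" by simp
  from assms have "u \<in> {0,1,2,3,4,5,6,7,8,9}" "v \<in> {0,1,2,3,4,5,6,7,8,9}"
    unfolding petersen_verts by blast+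
  then show ?thesis
    using assms(3) unfolding adj petersen_neighbors by (elim insertE emptyE; simp)
qed

end

theory Submission
  imports Defs
begin

text \<open>
  Two distinct vertices of the Petersen graph have no common neighbor if they are adjacent and
  exactly one otherwise. So a closed neighborhood has 4 elements, and two distinct ones share 2
  or 1 elements, according as their centers are adjacent or not; in particular they always meet.
  The coefficients follow from these numbers alone.

  Two vertices dominate at most 8 of the 10 vertices. Three vertices dominate all 10 only if the
  overlaps of their closed neighborhoods are as small as possible, and by inclusion and exclusion
  this forces a vertex common to the three. The dominating sets of size 3 are therefore the
  neighborhoods of the vertices (\<open>dominating_card_3_iff\<close>), of which there are 10.

  For larger sets, count the sets that fail to dominate. A set misses \<open>v\<close> if it lies in the
  complement of the closed neighborhood of \<open>v\<close>, which has 6 elements. It misses both \<open>u\<close> and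
  \<open>v\<close> if it lies in the complement of the union, which has 4 elements for adjacent \<open>u\<close>, \<open>v\<close> and
  3 for non-adjacent ones. Hence the vertices missed by a set of size at least 4 are pairwise
  adjacent, and, as there are no triangles, there are at most two of them. Inclusion and
  exclusion thus stops after the pairs: among the sets of size \<open>i \<ge> 4\<close>, exactly
  \<open>10 * (6 choose i) - 15 * (4 choose i)\<close> are not dominating, where 15 is the number of edges
  (\<open>num_dominating_sets_ge_4\<close>).
\<close>

section \<open>Closed neighborhoods in the Petersen graph\<close>

abbreviation neighbors :: "nat \<Rightarrow> nat set" where
  "neighbors v \<equiv> {u. v \<rightarrow>\<^bsub>petersen\<^esub> u}"

abbreviation nbhd :: "nat \<Rightarrow> nat set" where
  "nbhd \<equiv> closed_neighborhood petersen"

lemma adj_commute: "u \<rightarrow>\<^bsub>petersen\<^esub> v \<longleftrightarrow> v \<rightarrow>\<^bsub>petersen\<^esub> u"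
  by (simp add: petersen_adj_iff insert_commute)

lemma adj_irrefl: "\<not> u \<rightarrow>\<^bsub>petersen\<^esub> u"
  by (auto simp: petersen_adj_iff petersen_edges_eq doubleton_eq_iff)

lemma adj_in_verts:
  assumes "u \<rightarrow>\<^bsub>petersen\<^esub> v"
  shows "u \<in> verts petersen" "v \<in> verts petersen"
  using assms petersen_edges_bound[of u v] petersen_edges_bound[of v u]
  by (auto simp: petersen_adj_iff insert_commute petersen_def)

lemma finite_verts_petersen: "finite (verts petersen)"
  by (simp add: petersen_def)

lemma neighbors_subset: "neighbors v \<subseteq> verts petersen"
  using adj_in_verts by blast

lemma finite_neighbors: "finite (neighbors v)"
  using finite_subset[OF neighbors_subset finite_verts_petersen] .

lemma mem_nbhd_iff: "u \<in> nbhd v \<longleftrightarrow> u = v \<or> v \<rightarrow>\<^bsub>petersen\<^esub> u"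
  by (auto simp: closed_neighborhood_def)

lemma mem_nbhd_commute: "u \<in> nbhd v \<longleftrightarrow> v \<in> nbhd u"
  using adj_commute by (auto simp: mem_nbhd_iff)

lemma nbhd_subset: "v \<in> verts petersen \<Longrightarrow> nbhd v \<subseteq> verts petersen"
  using adj_in_verts by (auto simp: mem_nbhd_iff)

lemma finite_nbhd: "finite (nbhd v)"
  using finite_neighbors by (simp add: closed_neighborhood_def)

lemma card_nbhd: "v \<in> verts petersen \<Longrightarrow> card (nbhd v) = 4"
  using finite_neighbors[of v] by (simp add: closed_neighborhood_def petersen_cubic adj_irrefl)

lemma card_nbhd_Int:
  assumes "u \<in> verts petersen" "v \<in> verts petersen" "u \<noteq> v"
  shows "card (nbhd u \<inter> nbhd v) = (if u \<rightarrow>\<^bsub>petersen\<^esub> v then 2 else 1)"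
proof (cases "u \<rightarrow>\<^bsub>petersen\<^esub> v")
  case True
  then have "neighbors u \<inter> neighbors v = {}"
    using petersen_common_neighbors[OF assms] finite_neighbors by simp
  then have "nbhd u \<inter> nbhd v = {u, v}"
    using True adj_commute by (auto simp: closed_neighborhood_def)
  then show ?thesis using True assms by simp
next
  case False
  then have "nbhd u \<inter> nbhd v = neighbors u \<inter> neighbors v"
    using assms(3) adj_commute by (auto simp: closed_neighborhood_def)
  then show ?thesis using False petersen_common_neighbors[OF assms] by simp
qed

lemma no_triangle:
  assumes "u \<rightarrow>\<^bsub>petersen\<^esub> v" "v \<rightarrow>\<^bsub>petersen\<^esub> w" "u \<rightarrow>\<^bsub>petersen\<^esub> w"
  shows False
proof -
  have "u \<noteq> v" using assms(1) adj_irrefl by blast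
  then have "neighbors u \<inter> neighbors v = {}"
    using petersen_common_neighbors[of u v] adj_in_verts[OF assms(1)] assms(1) finite_neighbors
    by simp
  then show False using assms(2,3) by blast
qed

lemma card_outside_nbhd: "v \<in> verts petersen \<Longrightarrow> card (verts petersen - nbhd v) = 6"
  by (simp add: card_Diff_subset finite_nbhd nbhd_subset card_nbhd petersen_order)

lemma card_outside_two_nbhds:
  assumes "u \<in> verts petersen" "v \<in> verts petersen" "u \<noteq> v"
  shows "card (verts petersen - (nbhd u \<union> nbhd v)) = (if u \<rightarrow>\<^bsub>petersen\<^esub> v then 4 else 3)"
proof -
  have "card (nbhd u \<union> nbhd v) + card (nbhd u \<inter> nbhd v) = 8"
    using card_Un_Int[OF finite_nbhd finite_nbhd, of u v] assms by (simp add: card_nbhd)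
  then show ?thesis
    using assms card_nbhd_Int[OF assms]
    by (simp add: card_Diff_subset finite_nbhd nbhd_subset petersen_order split: if_splits)
qed

lemma dominating_imp_subset: "dominating_set petersen S \<Longrightarrow> S \<subseteq> verts petersen"
  by (simp add: dominating_set_def)

lemma dominating_iff_no_missed:
  "dominating_set petersen S \<longleftrightarrow>
     S \<subseteq> verts petersen \<and> {v \<in> verts petersen. S \<inter> nbhd v = {}} = {}"
proof -
  have "(\<Union>v\<in>S. nbhd v) = verts petersen \<longleftrightarrow>
      {v \<in> verts petersen. S \<inter> nbhd v = {}} = {}" if "S \<subseteq> verts petersen"
  proof -
    have "(\<Union>v\<in>S. nbhd v) = verts petersen \<longleftrightarrow> verts petersen \<subseteq> (\<Union>v\<in>S. nbhd v)"
      using that nbhd_subset by blast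
    also have "\<dots> \<longleftrightarrow> (\<forall>w\<in>verts petersen. \<exists>v\<in>S. v \<in> nbhd w)"
      by (simp add: subset_eq mem_nbhd_commute)
    finally show ?thesis by auto
  qed
  then show ?thesis unfolding dominating_set_def by blast
qed


section \<open>Dominating sets of size at most 3\<close>

lemma dominating_card_ge_3:
  assumes "dominating_set petersen S"
  shows "3 \<le> card S"
proof -
  have S: "S \<subseteq> verts petersen" and U: "(\<Union>v\<in>S. nbhd v) = verts petersen"
    using assms by (auto simp: dominating_set_def)
  have "10 = card (\<Union>v\<in>S. nbhd v)" using U petersen_order by simp
  also have "\<dots> \<le> (\<Sum>v\<in>S. card (nbhd v))"
    using card_UN_le finite_subset[OF S finite_verts_petersen] by blast
  also have "\<dots> = 4 * card S" using S card_nbhd by (simp add: subset_eq)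
  finally show ?thesis by simp
qed

lemma card_Un_three:
  assumes "finite A" "finite B" "finite C"
  shows "card (A \<union> B \<union> C) + card (A \<inter> B) + card (A \<inter> C) + card (B \<inter> C)
    = card A + card B + card C + card (A \<inter> B \<inter> C)"
proof -
  have "card (A \<union> B \<union> C) + card ((A \<inter> C) \<union> (B \<inter> C)) = card (A \<union> B) + card C"
    using card_Un_Int[of "A \<union> B" C] assms by (simp add: Int_Un_distrib2)
  moreover have "card ((A \<inter> C) \<union> (B \<inter> C)) + card (A \<inter> B \<inter> C) = card (A \<inter> C) + card (B \<inter> C)"
    using card_Un_Int[of "A \<inter> C" "B \<inter> C"] assms by (simp add: Int_ac)
  moreover have "card (A \<union> B) + card (A \<inter> B) = card A + card B"
    using card_Un_Int[of A B] assms by simp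
  ultimately show ?thesis by simp
qed

text \<open>
  A neighborhood dominates because the graph has diameter 2: a vertex at distance 2 from \<open>v\<close>
  shares a neighbor with \<open>v\<close>.
\<close>

lemma dominating_neighbors:
  assumes "v \<in> verts petersen"
  shows "dominating_set petersen (neighbors v)"
  unfolding dominating_iff_no_missed
proof (intro conjI neighbors_subset equals0I)
  fix w assume w: "w \<in> {w \<in> verts petersen. neighbors v \<inter> nbhd w = {}}"
  have "nbhd w \<inter> neighbors v \<noteq> {}"
  proof (cases "w = v")
    case True
    have "neighbors v \<noteq> {}" using petersen_cubic[OF assms] by force
    then show ?thesis using True by (auto simp: mem_nbhd_iff)
  next
    case ne: False
    show ?thesis
    proof (cases "v \<rightarrow>\<^bsub>petersen\<^esub> w")
      case True
      then show ?thesis by (auto simp: mem_nbhd_iff)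
    next
      case False
      then have "neighbors v \<inter> neighbors w \<noteq> {}"
        using petersen_common_neighbors[of v w] w ne assms by force
      then show ?thesis by (auto simp: mem_nbhd_iff)
    qed
  qed
  then show False using w by blast
qed

text \<open>
  Conversely, let \<open>p\<close>, \<open>q\<close>, \<open>r\<close> be the sizes of the pairwise intersections of the three closed
  neighborhoods and \<open>t\<close> that of the triple intersection. Domination means \<open>p + q + r = 2 + t\<close>, and
  \<open>t\<close> is at most each of \<open>p\<close>, \<open>q\<close>, \<open>r\<close>, which are positive. So \<open>p = q = r = t = 1\<close>: the three
  vertices are pairwise non-adjacent, and some vertex lies in all three closed neighborhoods.
\<close>

lemma dominating_card_3_iff:
  "dominating_set petersen S \<and> card S = 3 \<longleftrightarrow> (\<exists>v\<in>verts petersen. S = neighbors v)"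
proof
  assume "\<exists>v\<in>verts petersen. S = neighbors v"
  then show "dominating_set petersen S \<and> card S = 3"
    using dominating_neighbors petersen_cubic by blast
next
  assume S: "dominating_set petersen S \<and> card S = 3"
  then obtain a b c where abc: "S = {a, b, c}" "a \<noteq> b" "a \<noteq> c" "b \<noteq> c"
    by (auto simp: card_3_iff)
  have V: "a \<in> verts petersen" "b \<in> verts petersen" "c \<in> verts petersen"
    using S abc dominating_imp_subset by auto
  have "nbhd a \<union> nbhd b \<union> nbhd c = verts petersen"
    using S abc by (auto simp: dominating_set_def)
  then have sum: "card (nbhd a \<inter> nbhd b) + card (nbhd a \<inter> nbhd c) + card (nbhd b \<inter> nbhd c)
      = 2 + card (nbhd a \<inter> nbhd b \<inter> nbhd c)"
    using card_Un_three[OF finite_nbhd finite_nbhd finite_nbhd, of a b c] V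
    by (simp add: card_nbhd petersen_order)
  have "card (nbhd a \<inter> nbhd b \<inter> nbhd c) \<le> card (nbhd a \<inter> nbhd b)"
    "card (nbhd a \<inter> nbhd b \<inter> nbhd c) \<le> card (nbhd a \<inter> nbhd c)"
    "card (nbhd a \<inter> nbhd b \<inter> nbhd c) \<le> card (nbhd b \<inter> nbhd c)"
    by (rule card_mono; use finite_nbhd in auto)+
  moreover have "1 \<le> card (nbhd a \<inter> nbhd b)" "1 \<le> card (nbhd a \<inter> nbhd c)"
    "1 \<le> card (nbhd b \<inter> nbhd c)"
    using V abc by (simp_all add: card_nbhd_Int)
  ultimately have one: "card (nbhd a \<inter> nbhd b) = 1" "card (nbhd a \<inter> nbhd c) = 1"
    "card (nbhd b \<inter> nbhd c) = 1" "card (nbhd a \<inter> nbhd b \<inter> nbhd c) = 1"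
    using sum by linarith+
  have nonadj: "\<not> a \<rightarrow>\<^bsub>petersen\<^esub> b" "\<not> a \<rightarrow>\<^bsub>petersen\<^esub> c" "\<not> b \<rightarrow>\<^bsub>petersen\<^esub> c"
    using one(1-3) card_nbhd_Int[OF V(1,2) abc(2)] card_nbhd_Int[OF V(1,3) abc(3)]
      card_nbhd_Int[OF V(2,3) abc(4)] by presburger+
  obtain x where x: "x \<in> nbhd a" "x \<in> nbhd b" "x \<in> nbhd c"
    using one(4) by (auto simp: card_1_singleton_iff)
  then have "S \<subseteq> neighbors x"
    using abc nonadj nonadj[unfolded adj_commute[of a] adj_commute[of b c]]
      adj_commute[of x a] adj_commute[of x b] adj_commute[of x c]
    by (auto simp: mem_nbhd_iff)
  moreover have "x \<in> verts petersen" using x(1) V nbhd_subset by blast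
  ultimately have "S = neighbors x"
    using S petersen_cubic finite_neighbors by (metis card_subset_eq)
  then show "\<exists>v\<in>verts petersen. S = neighbors v"
    using \<open>x \<in> verts petersen\<close> by blast
qed

lemma inj_on_neighbors: "inj_on neighbors (verts petersen)"
proof (rule inj_onI, rule ccontr)
  fix u v assume *: "u \<in> verts petersen" "v \<in> verts petersen" "neighbors u = neighbors v" "u \<noteq> v"
  then have "card (neighbors u) \<le> 1"
    using petersen_common_neighbors[of u v] by (simp split: if_splits)
  then show False using petersen_cubic[OF *(1)] by simp
qed

lemma num_dominating_sets_3: "num_dominating_sets petersen 3 = 10"
proof -
  have "{S. dominating_set petersen S \<and> card S = 3} = neighbors ` verts petersen"
    using dominating_card_3_iff by blast
  then show ?thesis
    using card_image[OF inj_on_neighbors] petersen_order by (simp add: num_dominating_sets_def)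
qed

lemma domination_number_petersen: "domination_number petersen = 3"
  unfolding domination_number_def
proof (rule Min_eqI)
  show "finite (card ` {S. dominating_set petersen S})"
    by (rule finite_imageI, rule finite_subset[of _ "Pow (verts petersen)"])
      (auto simp: finite_verts_petersen dest: dominating_imp_subset)
  show "3 \<le> k" if "k \<in> card ` {S. dominating_set petersen S}" for k
    using that dominating_card_ge_3 by blast
  have "0 \<in> verts petersen" by (simp add: petersen_verts)
  then show "3 \<in> card ` {S. dominating_set petersen S}"
    using dominating_neighbors petersen_cubic by (metis image_eqI mem_Collect_eq)
qed


section \<open>Dominating sets of size at least 4\<close>

text \<open>Double counting of the pairs of an \<open>i\<close>-subset \<open>S\<close> of \<open>V\<close> and an index whose set avoids \<open>S\<close>.\<close>

lemma sum_card_avoided: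
  assumes "finite V" "finite I"
  shows "(\<Sum>S | S \<subseteq> V \<and> card S = i. card {x \<in> I. S \<inter> A x = {}})
    = (\<Sum>x\<in>I. card (V - A x) choose i)"
proof -
  let ?F = "{S. S \<subseteq> V \<and> card S = i}"
  have fin: "finite ?F" using assms(1) by simp
  have "(\<Sum>S\<in>?F. card {x \<in> I. S \<inter> A x = {}}) = (\<Sum>x\<in>I. card {S \<in> ?F. S \<inter> A x = {}})"
    using sum_multicount_gen[OF fin assms(2), of "\<lambda>S x. S \<inter> A x = {}"] by simp
  also have "\<dots> = (\<Sum>x\<in>I. card {S. S \<subseteq> V - A x \<and> card S = i})"
    by (intro sum.cong refl arg_cong[where f = card]) blast
  also have "\<dots> = (\<Sum>x\<in>I. card (V - A x) choose i)"
    using assms(1) by (simp add: n_subsets)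
  finally show ?thesis .
qed

lemma card_missed_le_2:
  assumes "S \<subseteq> verts petersen" "4 \<le> card S"
  shows "card {v \<in> verts petersen. S \<inter> nbhd v = {}} \<le> 2" (is "card ?M \<le> 2")
proof (rule ccontr)
  have adj: "u \<rightarrow>\<^bsub>petersen\<^esub> v" if "u \<in> ?M" "v \<in> ?M" "u \<noteq> v" for u v
  proof -
    have "S \<subseteq> verts petersen - (nbhd u \<union> nbhd v)" using that assms(1) by blast
    then have "card S \<le> card (verts petersen - (nbhd u \<union> nbhd v))"
      by (intro card_mono) (auto simp: finite_verts_petersen)
    then show ?thesis
      using assms(2) that card_outside_two_nbhds[of u v] by (simp split: if_splits)
  qed
  assume "\<not> card ?M \<le> 2"
  then have "3 \<le> card ?M" by simp
  then obtain T where T: "T \<subseteq> ?M" "card T = 3" by (meson obtain_subset_with_card_n)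
  obtain u v w where "T = {u, v, w}" "u \<noteq> v" "u \<noteq> w" "v \<noteq> w"
    using T(2) by (auto simp: card_3_iff)
  then have "u \<rightarrow>\<^bsub>petersen\<^esub> v" "v \<rightarrow>\<^bsub>petersen\<^esub> w" "u \<rightarrow>\<^bsub>petersen\<^esub> w"
    using adj T(1) by auto
  then show False by (rule no_triangle)
qed

text \<open>The three summands belong to \<open>v = u\<close>, to \<open>v\<close> adjacent to \<open>u\<close>, and to all other \<open>v\<close>.\<close>

lemma sum_choose_outside_two_nbhds:
  assumes u: "u \<in> verts petersen"
  shows "(\<Sum>v\<in>verts petersen. card (verts petersen - (nbhd u \<union> nbhd v)) choose i)
    = (6 choose i) + 3 * (4 choose i) + 6 * (3 choose i)"
proof -
  let ?f = "\<lambda>v. card (verts petersen - (nbhd u \<union> nbhd v)) choose i"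
  have "sum ?f (verts petersen) = sum ?f (verts petersen - nbhd u) + sum ?f (nbhd u)"
    using sum.subset_diff[OF nbhd_subset[OF u] finite_verts_petersen] .
  also have "sum ?f (nbhd u) = ?f u + sum ?f (neighbors u)"
    using finite_neighbors[of u] by (simp add: closed_neighborhood_def adj_irrefl)
  also have "?f u = 6 choose i" using card_outside_nbhd[OF u] by simp
  also have "sum ?f (neighbors u) = (\<Sum>v\<in>neighbors u. 4 choose i)"
  proof (rule sum.cong)
    fix v assume "v \<in> neighbors u"
    then show "?f v = 4 choose i"
      using card_outside_two_nbhds[of u v] u adj_in_verts[of u v] adj_irrefl[of u] by (cases "u = v") auto
  qed simp
  also have "\<dots> = 3 * (4 choose i)" using petersen_cubic[OF u] by simp
  also have "sum ?f (verts petersen - nbhd u) = (\<Sum>v\<in>verts petersen - nbhd u. 3 choose i)"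
  proof (rule sum.cong)
    fix v assume "v \<in> verts petersen - nbhd u"
    then show "?f v = 3 choose i"
      using card_outside_two_nbhds[of u v] u by (auto simp: mem_nbhd_iff)
  qed simp
  also have "\<dots> = 6 * (3 choose i)" using card_outside_nbhd[OF u] by simp
  finally show ?thesis by simp
qed

text \<open>
  Let \<open>m S\<close> be the number of vertices that \<open>S\<close> misses. Since \<open>m S \<le> 2\<close>, the number
  \<open>3 * m S - (m S)\<^sup>2\<close> is 0 if \<open>S\<close> dominates and 2 otherwise. So twice the number of non-dominating
  sets is obtained from the sums of \<open>m S\<close> and of \<open>(m S)\<^sup>2\<close>, which are counts of the sets that
  miss a given vertex and that miss both entries of a given ordered pair.
\<close>

lemma num_dominating_sets_ge_4:
  assumes "4 \<le> i"
  shows "num_dominating_sets petersen i + 10 * (6 choose i) = (10 choose i) + 15 * (4 choose i)"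
proof -
  let ?V = "verts petersen"
  let ?F = "{S. S \<subseteq> ?V \<and> card S = i}"
  define M where "M S = {v \<in> ?V. S \<inter> nbhd v = {}}" for S
  have finF: "finite ?F" using finite_verts_petersen by simp
  have sum1: "(\<Sum>S\<in>?F. card (M S)) = 10 * (6 choose i)"
    unfolding M_def
    by (subst sum_card_avoided) (simp_all add: finite_verts_petersen card_outside_nbhd petersen_order)
  have "(\<Sum>S\<in>?F. (card (M S))\<^sup>2)
      = (\<Sum>S\<in>?F. card {p \<in> ?V \<times> ?V. S \<inter> (nbhd (fst p) \<union> nbhd (snd p)) = {}})"
  proof (rule sum.cong)
    fix S
    have "{p \<in> ?V \<times> ?V. S \<inter> (nbhd (fst p) \<union> nbhd (snd p)) = {}} = M S \<times> M S"
      unfolding M_def by (auto simp: Int_Un_distrib)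
    then show "(card (M S))\<^sup>2 = card {p \<in> ?V \<times> ?V. S \<inter> (nbhd (fst p) \<union> nbhd (snd p)) = {}}"
      by (simp add: card_cartesian_product power2_eq_square)
  qed simp
  also have "\<dots> = (\<Sum>p\<in>?V \<times> ?V. card (?V - (nbhd (fst p) \<union> nbhd (snd p))) choose i)"
    by (rule sum_card_avoided) (simp_all add: finite_verts_petersen)
  also have "\<dots> = (\<Sum>u\<in>?V. \<Sum>v\<in>?V. card (?V - (nbhd u \<union> nbhd v)) choose i)"
    by (simp add: sum.cartesian_product case_prod_beta)
  also have "\<dots> = 10 * (6 choose i) + 30 * (4 choose i)"
    using assms by (simp add: sum_choose_outside_two_nbhds petersen_order)
  finally have sum2: "(\<Sum>S\<in>?F. (card (M S))\<^sup>2) = 10 * (6 choose i) + 30 * (4 choose i)" .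
  have "3 * card (M S) = (card (M S))\<^sup>2 + (if dominating_set petersen S then 0 else 2)"
    if "S \<in> ?F" for S
  proof -
    have "card (M S) \<le> 2" using card_missed_le_2[of S] that assms by (simp add: M_def)
    then have "card (M S) \<in> {0, 1, 2}" by auto
    moreover have "dominating_set petersen S \<longleftrightarrow> card (M S) = 0"
      using that finite_verts_petersen by (simp add: dominating_iff_no_missed M_def)
    ultimately show ?thesis by auto
  qed
  then have "(\<Sum>S\<in>?F. 3 * card (M S))
      = (\<Sum>S\<in>?F. (card (M S))\<^sup>2 + (if dominating_set petersen S then 0 else 2))"
    by (rule sum.cong[OF refl])
  moreover have "(\<Sum>S\<in>?F. if dominating_set petersen S then 0 else 2 :: nat)
      = 2 * card {S \<in> ?F. \<not> dominating_set petersen S}"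
    using finF by (simp add: sum.If_cases Int_def)
  ultimately have nondom:
    "30 * (6 choose i)
      = 10 * (6 choose i) + 30 * (4 choose i) + 2 * card {S \<in> ?F. \<not> dominating_set petersen S}"
    using sum1 sum2 by (simp add: sum.distrib flip: sum_distrib_left)
  have dom: "{S \<in> ?F. dominating_set petersen S} = {S. dominating_set petersen S \<and> card S = i}"
    using dominating_imp_subset by blast
  have "card ?F = card {S \<in> ?F. dominating_set petersen S}
      + card {S \<in> ?F. \<not> dominating_set petersen S}"
    using card_Int_Diff[OF finF, of "{S. dominating_set petersen S}"]
    by (simp add: Int_def set_diff_eq)
  then have "card ?F = num_dominating_sets petersen i
      + card {S \<in> ?F. \<not> dominating_set petersen S}"
    unfolding num_dominating_sets_def dom .
  moreover have "card ?F = 10 choose i"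
    using n_subsets[OF finite_verts_petersen] by (simp add: petersen_order)
  ultimately show ?thesis using nondom by simp
qed


section \<open>The domination polynomial\<close>

theorem theorem4:
  shows "domination_poly petersen =
    monom 1 10
    + monom (int (10 choose 9)) 9
    + monom (int (10 choose 8)) 8
    + monom (int (10 choose 7)) 7
    + monom (int (10 choose 6) - 10) 6
    + monom (int (10 choose 5) - 60) 5
    + monom 75 4
    + monom 10 3"
proof -
  let ?d = "num_dominating_sets petersen"
  have choose: "6 choose 4 = (15::nat)" "6 choose 5 = (6::nat)" "10 choose 4 = (210::nat)"
    by (simp_all add: eval_nat_numeral)
  have "?d 4 = 75" "?d 5 + 60 = 10 choose 5" "?d 6 + 10 = 10 choose 6" "?d 7 = 10 choose 7"
    "?d 8 = 10 choose 8" "?d 9 = 10 choose 9" "?d 10 = 1"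
    using num_dominating_sets_ge_4[of 4] num_dominating_sets_ge_4[of 5]
      num_dominating_sets_ge_4[of 6] num_dominating_sets_ge_4[of 7] num_dominating_sets_ge_4[of 8]
      num_dominating_sets_ge_4[of 9] num_dominating_sets_ge_4[of 10]
    by (simp_all add: choose binomial_eq_0)
  then have coeffs: "int (?d 3) = 10" "int (?d 4) = 75" "int (?d 5) = int (10 choose 5) - 60"
    "int (?d 6) = int (10 choose 6) - 10" "int (?d 7) = int (10 choose 7)"
    "int (?d 8) = int (10 choose 8)" "int (?d 9) = int (10 choose 9)" "int (?d 10) = 1"
    by (simp_all add: num_dominating_sets_3)
  have "{3..10} = {3, 4, 5, 6, 7, 8, 9, 10::nat}" by auto
  then have "domination_poly petersen = (\<Sum>i\<in>{3, 4, 5, 6, 7, 8, 9, 10}. monom (int (?d i)) i)"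
    unfolding domination_poly_def domination_number_petersen petersen_order by simp
  then show ?thesis by (simp only: coeffs sum.insert sum.empty finite.intros) (simp add: coeffs)
qed

end
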